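(* Let $d\geq 2$ be an integer such that $\tau^{-2}\le g(d)\le \frac12$. Then the longest length $A(d)$ of a monochromatic arithmetic progression of difference $d$ in the Fibonacci word satisfies \[ A(d)=2\left\lceil\frac{\tau^{-1}-g(d)}{g(2d)}\right\rceil . \]
   Context: Let $\tau=\frac12(1+\sqrt5)$ and let $\{x\}=x-\lfloor x\rfloor$ denote the fractional part of a real number $x$. For an integer $d\ge 1$ let $g(d)=\min(\{d\tau\},\,1-\{d\tau\})$ (the distance from $d\tau$ to the nearest integer). The Fibonacci word $\mathbf f=(f_i)_{i\ge 0}$ is the unique infinite word over $\{\mathtt 0,\mathtt 1\}$ fixed by the substitution $\mathtt 0\mapsto \mathtt{01},\ \mathtt 1\mapsto \mathtt 0$, i.e. $\mathbf f=\mathtt{0100101001001}\cdots$. A monochromatic arithmetic progression (MAP) of difference $d$ and length $\ell$ in $\mathbf f$ starting at position $i\geq 0$ means $f_i=f_{i+d}=f_{i+2d}=\cdots=f_{i+(\ell-1)d}$. For $d\ge1$, $A(d)$ is the maximum $\ell$ such that a MAP of difference $d$ and length $\ell$ occurs in $\mathbf f$ (with $A(d)=\infty$ if no finite maximum exists). *)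

theory Defs
  imports Complex_Main "HOL-Library.Stream" "HOL-Library.Extended_Nat"
begin

definition golden_ratio :: real where
  "golden_ratio = (1 + sqrt 5) / 2"

definition g :: "nat \<Rightarrow> real" where
  "g d = min (frac (real d * golden_ratio)) (1 - frac (real d * golden_ratio))"

text \<open>\<open>L0\<close> and \<open>L1\<close> are the letters 0 and 1.\<close>

datatype letter = L0 | L1

fun fib_subst :: "letter \<Rightarrow> letter list" where
  "fib_subst L0 = [L0, L1]"
| "fib_subst L1 = [L0]"

text \<open>The images of letters are nonempty, so \<^const>\<open>flat\<close> concatenates the images of all letters
  of an infinite word.\<close>

definition fib_subst_word :: "letter stream \<Rightarrow> letter stream" where
  "fib_subst_word w = flat (smap fib_subst w)"

definition fib_word :: "letter stream" where
  "fib_word = (THE w. fib_subst_word w = w)"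

definition is_MAP :: "letter stream \<Rightarrow> nat \<Rightarrow> nat \<Rightarrow> nat \<Rightarrow> bool" where
  "is_MAP w d l i \<longleftrightarrow> (\<forall>j<l. w !! (i + j * d) = w !! i)"

text \<open>In \<^typ>\<open>enat\<close> the supremum is the maximum if the lengths are bounded,
  and \<open>\<infinity>\<close> otherwise.\<close>

definition A :: "nat \<Rightarrow> enat" where
  "A d = (SUP l \<in> {l. \<exists>i. is_MAP fib_word d l i}. enat l)"

text \<open>The definite description in \<^const>\<open>fib_word\<close> is proper.\<close>

lemma fib_subst_nonempty [simp]: "fib_subst a \<noteq> []"
  by (cases a) auto

lemma fib_subst_word_Cons: "fib_subst_word (a ## w) = fib_subst a @- fib_subst_word w"
  by (simp add: fib_subst_word_def)

lemma fib_subst_word_shift: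
  "fib_subst_word (u @- w) = concat (map fib_subst u) @- fib_subst_word w"
  by (induction u) (simp_all add: fib_subst_word_Cons)

definition fib_prefix :: "nat \<Rightarrow> letter list" where
  "fib_prefix n = ((\<lambda>u. concat (map fib_subst u)) ^^ n) [L0]"

lemma fib_prefix_simps:
  "fib_prefix 0 = [L0]" "fib_prefix (Suc n) = concat (map fib_subst (fib_prefix n))"
  by (simp_all add: fib_prefix_def)

lemma fib_prefix_append: "\<exists>v. v \<noteq> [] \<and> fib_prefix (Suc n) = fib_prefix n @ v"
proof (induction n)
  case 0
  show ?case by (simp add: fib_prefix_simps)
next
  case (Suc n)
  then obtain v where v: "v \<noteq> []" "fib_prefix (Suc n) = fib_prefix n @ v" by blast
  have "fib_prefix (Suc (Suc n)) = concat (map fib_subst (fib_prefix n @ v))"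
    using v(2) fib_prefix_simps(2) by metis
  also have "\<dots> = fib_prefix (Suc n) @ concat (map fib_subst v)"
    by (simp add: fib_prefix_simps)
  finally show ?case
    using v(1) by (intro exI[of _ "concat (map fib_subst v)"]) (cases v; simp)
qed

lemma length_fib_prefix: "n < length (fib_prefix n)"
proof (induction n)
  case (Suc n)
  obtain v where "v \<noteq> []" "fib_prefix (Suc n) = fib_prefix n @ v"
    using fib_prefix_append by blast
  then have "length (fib_prefix n) < length (fib_prefix (Suc n))" by simp
  then show ?case using Suc by linarith
qed (simp add: fib_prefix_simps)

lemma fib_prefix_nth:
  assumes "m \<le> n" "i < length (fib_prefix m)"
  shows "i < length (fib_prefix n) \<and> fib_prefix n ! i = fib_prefix m ! i"
  using assms(1)
proof (induction n rule: dec_induct)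
  case (step n)
  obtain v where "fib_prefix (Suc n) = fib_prefix n @ v"
    using fib_prefix_append by blast
  then show ?case using step by (simp add: nth_append)
qed (use assms in simp)

lemma stream_eqI: "(\<And>n. w !! n = w' !! n) \<Longrightarrow> w = w'"
  by (metis smap_alt stream.map_id0 id_apply)

lemma fib_subst_word_fixed_unique:
  assumes "fib_subst_word w = w"
  shows "w !! n = fib_prefix n ! n"
proof -
  have hd: "shd w = L0"
  proof -
    have "w = fib_subst (shd w) @- fib_subst_word (stl w)"
      using assms fib_subst_word_Cons[of "shd w" "stl w"] by simp
    then have "shd w = hd (fib_subst (shd w))"
      by (metis fib_subst_nonempty shift_simps(1))
    then show ?thesis by (cases "shd w") auto
  qed
  have "\<exists>s. w = fib_prefix m @- s" for m
  proof (induction m)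
    case 0
    show ?case using hd by (intro exI[of _ "stl w"]) (simp add: fib_prefix_simps stream.expand)
  next
    case (Suc m)
    then obtain s where "w = fib_prefix m @- s" by blast
    then have "fib_subst_word w = fib_prefix (Suc m) @- fib_subst_word s"
      by (simp add: fib_subst_word_shift fib_prefix_simps)
    then show ?case using assms by metis
  qed
  then obtain s where "w = fib_prefix n @- s" by blast
  then show ?thesis using length_fib_prefix[of n] by (simp add: shift_snth_less)
qed

lemma fib_subst_word_fixed_exists: "\<exists>w. fib_subst_word w = w"
proof -
  define w where "w = smap (\<lambda>n. fib_prefix n ! n) nats"
  have nth: "w !! i = fib_prefix m ! i" if "i < length (fib_prefix m)" for i m
    using fib_prefix_nth[of m i i] fib_prefix_nth[of i m i] that length_fib_prefix[of i]
    by (cases "m \<le> i") (auto simp: w_def)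
  have pre: "w = fib_prefix m @- sdrop (length (fib_prefix m)) w" for m
  proof -
    have "stake (length (fib_prefix m)) w = fib_prefix m"
      by (rule nth_equalityI) (auto simp: nth)
    then show ?thesis by (metis stake_sdrop)
  qed
  have "fib_subst_word w !! n = w !! n" for n
  proof -
    have "fib_subst_word w = fib_prefix (Suc n) @- fib_subst_word (sdrop (length (fib_prefix n)) w)"
      using pre[of n] fib_subst_word_shift fib_prefix_simps(2) by metis
    moreover have "n < length (fib_prefix (Suc n))"
      using length_fib_prefix[of "Suc n"] by simp
    ultimately show ?thesis using nth[of n "Suc n"] by (simp add: shift_snth_less)
  qed
  then show ?thesis using stream_eqI by blast
qed

lemma fib_word_ex1: "\<exists>!w. fib_subst_word w = w"
  using fib_subst_word_fixed_exists fib_subst_word_fixed_unique stream_eqI by metis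

lemma fib_word_fixed: "fib_subst_word fib_word = fib_word"
  unfolding fib_word_def by (rule theI'[OF fib_word_ex1])

end

theory Submission
  imports Defs "HOL-Analysis.Kronecker_Approximation_Theorem"
begin

text \<open>The Fibonacci word codes the rotation by \<open>\<tau>\<close>: its letter at position \<open>i\<close> is
  \<^const>\<open>L0\<close> iff \<open>{(i + 1) \<tau>}\<close> lies in \<open>J = [\<tau>\<^sup>-\<^sup>2, 1)\<close>. A progression of
  difference \<open>d\<close> is, up to reversal, an orbit of the rotation by \<open>g = g(d)\<close>. Since \<open>g\<close> exceeds
  the length of the complement of \<open>J\<close>, no two consecutive points lie in the complement; and
  two consecutive points of \<open>J\<close> differ alternately by \<open>g\<close> and by \<open>g - 1\<close>, so every second point
  moves to the left by \<open>g(2d) = 1 - 2g\<close>. The orbit is longest when it starts in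
  \<open>[\<tau>\<^sup>-\<^sup>2, 1 - g)\<close>, an interval of length \<open>\<tau>\<^sup>-\<^sup>1 - g\<close>, as far to the right as possible.\<close>

section \<open>Arithmetic of the golden ratio\<close>

abbreviation tau :: real ("\<tau>") where "\<tau> \<equiv> golden_ratio"

lemma golden_ratio_sq: "\<tau> * \<tau> = \<tau> + 1"
  by (simp add: golden_ratio_def field_simps)

text \<open>This enclosure settles the numerical comparisons below. In particular it gives
  \<open>1/3 < 2 - \<tau>\<close> and \<open>2 - \<tau> < 1/2\<close>.\<close>

lemma golden_ratio_bounds: "8/5 < \<tau>" "\<tau> < 33/20"
proof -
  have "sqrt ((11/5)\<^sup>2) < sqrt 5" by (subst real_sqrt_less_iff) (simp add: power2_eq_square)
  then show "8/5 < \<tau>" by (simp add: golden_ratio_def)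
  have "sqrt 5 < sqrt ((23/10)\<^sup>2)" by (subst real_sqrt_less_iff) (simp add: power2_eq_square)
  then show "\<tau> < 33/20" by (simp add: golden_ratio_def)
qed

lemma golden_ratio_powi:
  "\<tau> powi (-1) = \<tau> - 1" "\<tau> powi (-2) = 2 - \<tau>"
proof -
  have "\<tau> * (\<tau> - 1) = 1" using golden_ratio_sq by (simp add: algebra_simps)
  then have inv: "inverse \<tau> = \<tau> - 1" by (rule inverse_unique)
  then show "\<tau> powi (-1) = \<tau> - 1" by (simp add: power_int_minus)
  have "\<tau> powi (-2) = inverse \<tau> * inverse \<tau>"
    by (simp add: power_int_minus power2_eq_square)
  also have "\<dots> = 2 - \<tau>" unfolding inv using golden_ratio_sq by (simp add: algebra_simps)
  finally show "\<tau> powi (-2) = 2 - \<tau>" .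
qed

text \<open>A rational root of \<open>x^2 - x - 1\<close> would have denominator 1, but \<tau> lies
  strictly between the integers 1 and 2.\<close>

lemma golden_ratio_irrational: "\<tau> \<notin> \<rat>"
proof
  assume "\<tau> \<in> \<rat>"
  then obtain a b :: int where ab: "b > 0" "coprime a b" "\<tau> = of_int a / of_int b"
    by (meson Rats_cases')
  have "real_of_int (a * a) = real_of_int (b * (a + b))"
    using golden_ratio_sq ab(1) unfolding ab(3) by (simp add: field_simps)
  then have "a * a = b * (a + b)" by (simp only: of_int_eq_iff)
  then have "b dvd a * a" by simp
  moreover have "coprime b (a * a)" using ab(2) by (simp add: coprime_commute)
  ultimately have "is_unit b" by (metis coprime_absorb_left)
  then have "b = 1" using ab(1) by simp
  then have "\<tau> = of_int a" using ab by simp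
  then have "1 < a" "a < 2" using golden_ratio_bounds by linarith+
  then show False by simp
qed

text \<open>Irrationality in the form that excludes boundary cases: hitting an endpoint exactly
  would make a nonzero integer multiple of \<tau> an integer.\<close>

lemma of_int_mult_golden_ratio_Ints_iff: "of_int k * \<tau> \<in> \<int> \<longleftrightarrow> k = 0"
proof
  assume "of_int k * \<tau> \<in> \<int>"
  then have "of_int k * \<tau> \<in> \<rat>" using Ints_subset_Rats by blast
  then show "k = 0"
    by (metis Rats_divide Rats_of_int golden_ratio_irrational nonzero_mult_div_cancel_left
        of_int_0_eq_iff)
qed simp

section \<open>The Fibonacci word as a coding of the rotation by \<tau>\<close>

definition sturmian_letter :: "nat \<Rightarrow> letter" where
  "sturmian_letter i = (if 2 - \<tau> \<le> frac (real (i + 1) * \<tau>) then L0 else L1)"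

text \<open>The lower Wythoff sequence. Its role here: in the substituted word, the image of letter
  \<open>n\<close> starts at position \<open>floor_tau (n + 1) - 1\<close>.\<close>

definition floor_tau :: "nat \<Rightarrow> nat" where
  "floor_tau n = nat \<lfloor>real n * \<tau>\<rfloor>"

lemma real_floor_tau: "real (floor_tau n) = real n * \<tau> - frac (real n * \<tau>)"
proof -
  have "0 \<le> real n * \<tau>" using golden_ratio_bounds by simp
  then show ?thesis by (simp add: floor_tau_def frac_def)
qed

lemma floor_tau_pos: "0 < n \<Longrightarrow> 0 < floor_tau n"
proof -
  assume "0 < n"
  then have "1 * 1 \<le> real n * \<tau>" using golden_ratio_bounds by (intro mult_mono) auto
  then show ?thesis by (simp add: floor_tau_def)
qed

text \<open>Adding \<tau> to the fractional part \<open>e\<close> passes 2 exactly when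
  \<open>2 - \<tau> \<le> e\<close>, the condition for letter \<open>L0\<close>. So the floor grows
  by 2 or 1, like the length of the image.\<close>

lemma floor_tau_Suc:
  "floor_tau (n + 2) = floor_tau (n + 1) + length (fib_subst (sturmian_letter n))"
proof -
  define e where "e = frac (real (n + 1) * \<tau>)"
  define s where "s = (if 2 - \<tau> \<le> e then 2 else 1 :: nat)"
  have "0 \<le> e" "e < 1" by (simp_all add: e_def frac_lt_1)
  then have "0 \<le> e + \<tau> - s \<and> e + \<tau> - s < 1"
    using golden_ratio_bounds by (auto simp: s_def)
  moreover have "real (n + 2) * \<tau> - (e + \<tau> - s) = of_int (\<lfloor>real (n + 1) * \<tau>\<rfloor> + int s)"
    by (simp add: e_def frac_def algebra_simps)
  then have "real (n + 2) * \<tau> - (e + \<tau> - s) \<in> \<int>" by (metis Ints_of_int)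
  ultimately have "frac (real (n + 2) * \<tau>) = e + \<tau> - s"
    by (simp add: frac_unique_iff)
  then have "real (floor_tau (n + 2)) = real (floor_tau (n + 1) + s)"
    by (simp add: real_floor_tau e_def algebra_simps)
  then have "floor_tau (n + 2) = floor_tau (n + 1) + s" by (simp only: of_nat_eq_iff)
  then show ?thesis by (simp add: s_def e_def sturmian_letter_def)
qed

text \<open>Since \<open>\<tau> * \<tau> = \<tau> + 1\<close>, the product of \<open>\<tau>\<close>
  and \<open>n * \<tau> - e\<close> is \<open>n + (n * \<tau> - e) - e * (\<tau> - 1)\<close>, where
  only the last term is not an integer. Irrationality gives \<open>0 < e\<close>, which keeps the
  claimed value below 1.\<close>

lemma frac_floor_tau:
  assumes "0 < n"
  defines "e \<equiv> frac (real n * \<tau>)"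
  shows "frac (real (floor_tau n) * \<tau>) = 1 - e * (\<tau> - 1)"
proof -
  have "of_int (int n) * \<tau> \<notin> \<int>" using assms(1) by (simp only: of_int_mult_golden_ratio_Ints_iff)
  then have e: "0 < e" "e < 1" by (simp_all add: e_def frac_lt_1)
  have lt: "e * (\<tau> - 1) < 1 * 1"
    using e golden_ratio_bounds by (intro mult_strict_mono) auto
  have pos: "0 < e * (\<tau> - 1)" using e golden_ratio_bounds by simp
  have "real (floor_tau n) * \<tau> - (1 - e * (\<tau> - 1))
      = real n * (\<tau> * \<tau>) - e - 1"
    by (simp add: real_floor_tau e_def algebra_simps)
  also have "\<dots> = of_int (int n + \<lfloor>real n * \<tau>\<rfloor> - 1)"
    unfolding golden_ratio_sq e_def by (simp add: frac_def algebra_simps)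
  finally have "real (floor_tau n) * \<tau> - (1 - e * (\<tau> - 1)) \<in> \<int>" by (metis Ints_of_int)
  then show ?thesis using lt pos by (simp add: frac_unique_iff)
qed

text \<open>The point at the start of an image is \<open>1 - e * (\<tau> - 1)\<close>, which exceeds
  \<open>2 - \<tau>\<close> because \<open>e < 1\<close>; so every image starts with
  \<open>L0\<close>. If letter \<open>n\<close> is \<open>L0\<close>, then \<open>e\<close> is so
  large that the next point falls below \<open>2 - \<tau>\<close>, which gives
  \<open>L1\<close>.\<close>

lemma sturmian_letter_floor_tau:
  assumes "k < length (fib_subst (sturmian_letter n))"
  shows "sturmian_letter (floor_tau (n + 1) - 1 + k) = fib_subst (sturmian_letter n) ! k"
proof -
  define e where "e = frac (real (n + 1) * \<tau>)"
  have e: "0 \<le> e" "e < 1" by (simp_all add: e_def frac_lt_1)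
  have fr: "frac (real (floor_tau (n + 1)) * \<tau>) = 1 - e * (\<tau> - 1)"
    unfolding e_def by (rule frac_floor_tau) simp
  have pos: "0 < floor_tau (n + 1)" by (rule floor_tau_pos) simp
  consider "k = 0" | "k = 1" "sturmian_letter n = L0"
    using assms by (cases "sturmian_letter n") (auto simp: less_Suc_eq)
  then show ?thesis
  proof cases
    case 1
    have "e * (\<tau> - 1) \<le> 1 * (\<tau> - 1)"
      using e golden_ratio_bounds by (intro mult_right_mono) auto
    then have "sturmian_letter (floor_tau (n + 1) - 1) = L0"
      using fr pos by (simp add: sturmian_letter_def)
    then show ?thesis using 1 by (cases "sturmian_letter n") auto
  next
    case 2
    then have "2 - \<tau> \<le> e"
      by (auto simp: sturmian_letter_def e_def split: if_splits)
    \<comment> \<open>Strictness matters: with equality the next point would be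
      \<open>2 - \<tau>\<close> itself, which codes \<open>L0\<close>.\<close>
    moreover have "e \<noteq> 2 - \<tau>"
    proof
      assume "e = 2 - \<tau>"
      then have "of_int (int n + 2) * \<tau> = of_int (2 + \<lfloor>real (n + 1) * \<tau>\<rfloor>)"
        by (simp add: e_def frac_def algebra_simps)
      then have "of_int (int n + 2) * \<tau> \<in> \<int>" by (metis Ints_of_int)
      then show False using of_int_mult_golden_ratio_Ints_iff[of "int n + 2"] by simp
    qed
    ultimately have "(2 - \<tau>) * (\<tau> - 1) < e * (\<tau> - 1)"
      using golden_ratio_bounds by (intro mult_strict_right_mono) auto
    then have lower: "2 * \<tau> - 3 < e * (\<tau> - 1)" using golden_ratio_sq by (simp add: algebra_simps)
    have upper: "e * (\<tau> - 1) \<le> 1 * (\<tau> - 1)"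
      using e golden_ratio_bounds by (intro mult_right_mono) auto
    have "real (floor_tau (n + 1) + 1) * \<tau> - (\<tau> - 1 - e * (\<tau> - 1))
        = real (floor_tau (n + 1)) * \<tau> - frac (real (floor_tau (n + 1)) * \<tau>) + 2"
      unfolding fr by (simp add: algebra_simps)
    also have "\<dots> = of_int (\<lfloor>real (floor_tau (n + 1)) * \<tau>\<rfloor> + 2)" by (simp add: frac_def)
    finally have "real (floor_tau (n + 1) + 1) * \<tau> - (\<tau> - 1 - e * (\<tau> - 1)) \<in> \<int>"
      by (metis Ints_of_int)
    then have "frac (real (floor_tau (n + 1) + 1) * \<tau>) = \<tau> - 1 - e * (\<tau> - 1)"
      using lower upper golden_ratio_bounds e by (simp add: frac_unique_iff)
    then have "sturmian_letter (floor_tau (n + 1)) = L1"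
      using lower by (simp add: sturmian_letter_def)
    then show ?thesis using 2 pos by simp
  qed
qed

lemma fib_word_nth: "fib_word !! i = sturmian_letter i"
proof -
  define w where "w = smap sturmian_letter nats"
  have w: "w !! i = sturmian_letter i" for i by (simp add: w_def)
  \<comment> \<open>Stated for all suffixes, so that the induction on \<open>k\<close> can strip the
    image of one letter and continue with the next suffix.\<close>
  have step: "fib_subst_word (sdrop n w) !! k = w !! (floor_tau (n + 1) - 1 + k)" for n k
  proof (induction k arbitrary: n rule: less_induct)
    case (less k)
    let ?u = "fib_subst (sturmian_letter n)"
    have "sdrop n w = sturmian_letter n ## sdrop (n + 1) w"
      by (metis Suc_eq_plus1 sdrop_simps stream.collapse w)
    then have eq: "fib_subst_word (sdrop n w) = ?u @- fib_subst_word (sdrop (n + 1) w)"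
      by (simp add: fib_subst_word_Cons)
    show ?case
    proof (cases "k < length ?u")
      case True
      then show ?thesis unfolding eq using sturmian_letter_floor_tau[of k n] by (simp add: w)
    next
      case False
      have "0 < length ?u" by simp
      then have "fib_subst_word (sdrop (n + 1) w) !! (k - length ?u)
          = w !! (floor_tau (n + 1 + 1) - 1 + (k - length ?u))"
        using False less.IH[of "k - length ?u" "n + 1"] by linarith
      also have "floor_tau (n + 1 + 1) - 1 + (k - length ?u) = floor_tau (n + 1) - 1 + k"
        using floor_tau_Suc[of n] False floor_tau_pos[of "n + 1"] by simp
      finally show ?thesis unfolding eq using False by (simp add: shift_snth_ge)
    qed
  qed
  \<comment> \<open>For \<open>n = 0\<close> the offset \<open>floor_tau 1 - 1\<close> vanishes, so
    the coding word is the fixed point.\<close>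
  have "\<lfloor>\<tau>\<rfloor> = 1" using golden_ratio_bounds by (simp add: floor_eq_iff)
  then have "floor_tau (0 + 1) = 1" by (simp add: floor_tau_def)
  then have "fib_subst_word w = w"
    using step[of 0] by (intro stream_eqI) simp
  then have "fib_word = w" using fib_word_ex1 fib_word_fixed by blast
  then show ?thesis using w by simp
qed

lemma fib_word_nth_eq_L0_iff: "fib_word !! i = L0 \<longleftrightarrow> 2 - \<tau> \<le> frac (real (i + 1) * \<tau>)"
  by (simp add: fib_word_nth sturmian_letter_def)

text \<open>Kronecker's theorem at the midpoint of the interval, with half its width as tolerance.
  It later supplies the starting position of a longest progression.\<close>

lemma frac_golden_ratio_dense:
  assumes "0 \<le> u" "u < v" "v \<le> 1"
  obtains i where "u < frac (real (i + 1) * \<tau>)" "frac (real (i + 1) * \<tau>) < v"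
proof -
  obtain k where k: "0 < k" "\<bar>frac (real k * \<tau>) - (u + v) / 2\<bar> < (v - u) / 2"
    by (rule Kronecker_approx_1_explicit[OF golden_ratio_irrational,
          of "(u + v) / 2" "(v - u) / 2"]) (use assms in auto)
  have "frac (real k * \<tau>) - (u + v) / 2 < (v - u) / 2"
    "- ((v - u) / 2) < frac (real k * \<tau>) - (u + v) / 2"
    using k(2) by linarith+
  moreover have "k - 1 + 1 = k" using k(1) by simp
  ultimately show thesis using that[of "k - 1"] by (simp add: field_simps)
qed

section \<open>Orbits of a rotation inside an interval\<close>

lemma rotation_step:
  fixes b c p q :: real
  assumes "q - p - c \<in> \<int>" "b \<le> p" "p < 1" "b \<le> q" "q < 1" "0 \<le> b" "0 \<le> c" "c < 1"
  shows "q = p + c \<or> q = p + c - 1"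
proof -
  obtain m :: int where m: "q - p - c = of_int m" using assms(1) by (auto elim: Ints_cases)
  then have "of_int m < (1 :: real)" "(- 2 :: real) < of_int m" using assms by linarith+
  then have "m = 0 \<or> m = -1" by linarith
  then show ?thesis using m by auto
qed

lemma rotation_orbit_length_le:
  fixes b c :: real and x :: "nat \<Rightarrow> real"
  assumes b: "1/3 < b" "b < c" and c: "c < 1/2" "c < 1 - b"
    and rot: "\<And>j. Suc j < l \<Longrightarrow> x (Suc j) - x j - c \<in> \<int>"
    and mem: "\<And>j. j < l \<Longrightarrow> b \<le> x j \<and> x j < 1"
  shows "l \<le> 2 * nat \<lceil>(1 - b - c) / (1 - 2 * c)\<rceil>"
proof (rule ccontr)
  define n where "n = nat \<lceil>(1 - b - c) / (1 - 2 * c)\<rceil>"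
  assume "\<not> ?thesis"
  then have l: "2 * n < l" by (simp add: n_def)
  have "(1 - b - c) / (1 - 2 * c) \<le> real n" unfolding n_def by linarith
  then have n: "1 - b - c \<le> real n * (1 - 2 * c)" using c by (simp add: field_simps)
  then have "n \<noteq> 0" using c by (intro notI) simp
  have step: "x (Suc j) = x j + c \<or> x (Suc j) = x j + c - 1" if "Suc j < l" for j
    using rotation_step[OF rot[OF that], of b] mem[of j] mem[of "Suc j"] that b c by auto
  \<comment> \<open>Two steps by \<open>c\<close> would reach at least \<open>b + 2 * c > 1\<close>,
    and two steps by \<open>c - 1\<close> would end below 0. So the two kinds alternate, with net
    shift \<open>2 * c - 1\<close>.\<close>
  have two: "x (Suc (Suc j)) = x j - (1 - 2 * c)" if "Suc (Suc j) < l" for j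
    using step[of j] step[of "Suc j"] mem[of j] mem[of "Suc (Suc j)"] that b c by auto
  have iter: "x (j + 2 * k) = x j - real k * (1 - 2 * c)" if "j + 2 * k < l" for j k
    using that by (induction k) (simp_all add: two algebra_simps)
  from \<open>n \<noteq> 0\<close> obtain m where m: "n = Suc m" by (cases n) auto
  have "x 1 = x 0 + c \<or> x 1 = x 0 + c - 1" using step[of 0] l m by simp
  then show False
  proof
    \<comment> \<open>Here \<open>x 0 < 1 - c\<close>, and \<open>n\<close> double steps move left
      by at least \<open>1 - b - c\<close>, hence below \<open>b\<close>.\<close>
    assume "x 1 = x 0 + c"
    moreover have "x 1 < 1" using mem[of 1] l m by simp
    moreover have "b \<le> x (0 + 2 * n)" using mem l by simp
    ultimately show False using iter[of 0 n] l n by linarith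
  next
    \<comment> \<open>Here \<open>x 1 < c\<close>. The \<open>m\<close> double steps that follow end
      at or above \<open>b\<close>, so they cover less than \<open>c - b\<close>; one more
      \<open>1 - 2 * c\<close> makes less than \<open>1 - b - c\<close>, against the choice of
      \<open>n\<close>.\<close>
    assume "x 1 = x 0 + c - 1"
    moreover have "x 0 < 1" using mem[of 0] l by simp
    moreover have "b \<le> x (1 + 2 * m)" using mem l m by simp
    moreover have "real n * (1 - 2 * c) = real m * (1 - 2 * c) + (1 - 2 * c)"
      by (simp add: m algebra_simps)
    ultimately show False using iter[of 1 m] l m n by linarith
  qed
qed

text \<open>The alternating orbit in closed form, starting at \<open>b + y\<close>. The lower bound
  on \<open>y\<close> keeps the last even point at or above \<open>b\<close>; the upper bound keeps
  the first odd point below 1.\<close>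

lemma rotation_orbit_mem:
  fixes b c y :: real
  assumes b: "0 \<le> b" "b < c" and y: "real m * (1 - 2 * c) \<le> y" "y < 1 - b - c" and c: "c \<le> 1/2"
  defines "z \<equiv> \<lambda>j. b + y - real (j div 2) * (1 - 2 * c) + real (j mod 2) * c"
  shows "j < 2 * Suc m \<Longrightarrow> b \<le> z j \<and> z j < 1" "z j - z 0 - real j * c \<in> \<int>"
proof -
  have "real j = real (2 * (j div 2) + j mod 2)" by simp
  then have "real j = 2 * real (j div 2) + real (j mod 2)" by linarith
  then have "z j - z 0 - real j * c = of_int (- int (j div 2))"
    by (simp add: z_def algebra_simps)
  then show "z j - z 0 - real j * c \<in> \<int>" by (metis Ints_of_int)
  assume "j < 2 * Suc m"
  then have "j div 2 \<le> m" by auto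
  then have "real (j div 2) * (1 - 2 * c) \<le> real m * (1 - 2 * c)"
    using c by (intro mult_right_mono) auto
  moreover have "0 \<le> real (j div 2) * (1 - 2 * c)" using c by simp
  moreover have "0 \<le> real (j mod 2) * c" "real (j mod 2) * c \<le> c"
    using b by (auto simp: mod_2_eq_odd)
  ultimately show "b \<le> z j \<and> z j < 1" using y by (simp add: z_def)
qed

section \<open>The distance to the nearest integer\<close>

lemma g_cases:
  obtains "frac (real d * \<tau>) = g d" "real d * \<tau> - g d \<in> \<int>"
    | "frac (real d * \<tau>) = 1 - g d" "real d * \<tau> + g d \<in> \<int>"
proof -
  have "real d * \<tau> - frac (real d * \<tau>) = of_int \<lfloor>real d * \<tau>\<rfloor>" by (simp add: frac_def)
  moreover have "real d * \<tau> - frac (real d * \<tau>) + 1 = of_int (\<lfloor>real d * \<tau>\<rfloor> + 1)"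
    by (simp add: frac_def)
  ultimately have Z: "real d * \<tau> - frac (real d * \<tau>) \<in> \<int>" "real d * \<tau> - frac (real d * \<tau>) + 1 \<in> \<int>"
    by (metis Ints_of_int)+
  show thesis
  proof (cases "frac (real d * \<tau>) \<le> 1 - frac (real d * \<tau>)")
    case True
    then have "frac (real d * \<tau>) = g d" by (simp add: g_def)
    then show thesis using that(1) Z(1) by simp
  next
    case False
    then have "frac (real d * \<tau>) = 1 - g d" by (simp add: g_def)
    then show thesis using that(2) Z(2) by simp
  qed
qed

text \<open>Equality would make \<open>2 * d * \<tau>\<close> an integer.\<close>

lemma g_ne_half:
  assumes "0 < d"
  shows "g d \<noteq> 1/2"
proof
  assume eq: "g d = 1/2"
  have "of_int (2 * int d) * \<tau> = (real d * \<tau> - g d) + (real d * \<tau> - g d) + 1"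
    "of_int (2 * int d) * \<tau> = (real d * \<tau> + g d) + (real d * \<tau> + g d) - 1"
    using eq by (simp_all add: algebra_simps)
  then have "of_int (2 * int d) * \<tau> \<in> \<int>"
    by (cases rule: g_cases[of d]) (metis Ints_add Ints_diff Ints_1)+
  then show False using of_int_mult_golden_ratio_Ints_iff[of "2 * int d"] assms by simp
qed

text \<open>Equality would make \<open>(d + 1) * \<tau>\<close> or \<open>(d - 1) * \<tau>\<close>
  an integer. For \<open>d = 1\<close> the second product is 0, and equality does hold.\<close>

lemma g_ne_golden:
  assumes "2 \<le> d"
  shows "g d \<noteq> 2 - \<tau>"
proof
  assume eq: "g d = 2 - \<tau>"
  have "of_int (int d + 1) * \<tau> = (real d * \<tau> - g d) + 2"
    "of_int (int d - 1) * \<tau> = (real d * \<tau> + g d) - 2"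
    using eq by (simp_all add: algebra_simps)
  then have "of_int (int d + 1) * \<tau> \<in> \<int> \<or> of_int (int d - 1) * \<tau> \<in> \<int>"
    by (cases rule: g_cases[of d]) (metis Ints_add Ints_diff Ints_numeral)+
  then have "int d + 1 = 0 \<or> int d - 1 = 0" by (simp only: of_int_mult_golden_ratio_Ints_iff)
  then show False using assms by linarith
qed

text \<open>Modulo 1, \<open>2 * d * \<tau>\<close> is \<open>2 * g d\<close> up to sign. As
  \<open>2 * g d\<close> lies between 2/3 and 1, its nearest integer is 1.\<close>

lemma g_double:
  assumes "1/3 \<le> g d" "g d < 1/2"
  shows "g (2 * d) = 1 - 2 * g d"
proof (cases rule: g_cases[of d])
  case 1
  have "real (2 * d) * \<tau> - 2 * g d = (real d * \<tau> - g d) + (real d * \<tau> - g d)" by simp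
  then have "real (2 * d) * \<tau> - 2 * g d \<in> \<int>" using 1 by (metis Ints_add)
  then have "frac (real (2 * d) * \<tau>) = 2 * g d" using assms by (simp add: frac_unique_iff)
  then show ?thesis using assms by (simp add: g_def[of "2 * d"])
next
  case 2
  have "real (2 * d) * \<tau> - (1 - 2 * g d) = (real d * \<tau> + g d) + (real d * \<tau> + g d) - 1" by simp
  then have "real (2 * d) * \<tau> - (1 - 2 * g d) \<in> \<int>" using 2 by (metis Ints_add Ints_diff Ints_1)
  then have "frac (real (2 * d) * \<tau>) = 1 - 2 * g d" using assms by (simp add: frac_unique_iff)
  then show ?thesis using assms by (simp add: g_def[of "2 * d"])
qed

section \<open>Lengths of progressions in the Fibonacci word\<close>

lemma frac_AP_step:
  "frac (real (i + Suc j * d + 1) * \<tau>) - frac (real (i + j * d + 1) * \<tau>) - real d * \<tau> \<in> \<int>"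
proof -
  have "frac (real (i + Suc j * d + 1) * \<tau>) - frac (real (i + j * d + 1) * \<tau>) - real d * \<tau>
      = of_int (\<lfloor>real (i + j * d + 1) * \<tau>\<rfloor> - \<lfloor>real (i + Suc j * d + 1) * \<tau>\<rfloor>)"
    by (simp add: frac_def algebra_simps)
  then show ?thesis by (metis Ints_of_int)
qed

lemma MAP_L1_length_le:
  assumes "is_MAP fib_word d l i" "fib_word !! i = L1" "2 - \<tau> < g d" "g d < 1/2"
  shows "l \<le> 1"
proof (rule ccontr)
  assume "\<not> l \<le> 1"
  then have "1 < l" by simp
  then have "fib_word !! (i + 1 * d) = L1" using assms(1,2) unfolding is_MAP_def by metis
  define p q where "p = frac (real (i + 0 * d + 1) * \<tau>)" "q = frac (real (i + Suc 0 * d + 1) * \<tau>)"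
  have p: "0 \<le> p" "p < 2 - \<tau>"
    using fib_word_nth_eq_L0_iff[of i] assms(2) by (simp_all add: p_q_def)
  have q: "0 \<le> q" "q < 2 - \<tau>"
    using fib_word_nth_eq_L0_iff[of "i + 1 * d"] \<open>fib_word !! (i + 1 * d) = L1\<close>
    by (simp_all add: p_q_def)
  have Z: "q - p - real d * \<tau> \<in> \<int>" unfolding p_q_def by (rule frac_AP_step)
  have "q - p - g d \<in> \<int> \<or> p - q - g d \<in> \<int>"
  proof (cases rule: g_cases[of d])
    case 1
    have "q - p - g d = (q - p - real d * \<tau>) + (real d * \<tau> - g d)" by simp
    then show ?thesis using 1 Z by (metis Ints_add)
  next
    case 2
    have "p - q - g d = - (q - p - real d * \<tau>) - (real d * \<tau> + g d)" by simp
    then show ?thesis using 2 Z by (metis Ints_diff Ints_minus)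
  qed
  then obtain m :: int where "q - p - g d = of_int m \<or> p - q - g d = of_int m"
    by (auto elim: Ints_cases)
  \<comment> \<open>Both points lie in an interval of length \<open>2 - \<tau> < g d\<close>, so
    subtracting \<open>g d\<close> from their difference gives a value strictly between
    \<open>- 2 * g d\<close> and 0, where \<open>2 * g d < 1\<close>.\<close>
  then have "of_int m < (0 :: real)" "(- 1 :: real) < of_int m"
    using p q assms(3,4) by linarith+
  then have "m < 0" "-1 < m" by linarith+
  then show False by simp
qed

lemma MAP_L0_length_le:
  assumes "is_MAP fib_word d l i" "fib_word !! i = L0" "2 - \<tau> < g d" "g d < 1/2"
  shows "l \<le> 2 * nat \<lceil>(\<tau> - 1 - g d) / (1 - 2 * g d)\<rceil>"
proof -
  define x where "x j = frac (real (i + j * d + 1) * \<tau>)" for j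
  have mem: "2 - \<tau> \<le> x j \<and> x j < 1" if "j < l" for j
    using fib_word_nth_eq_L0_iff[of "i + j * d"] assms(1,2) that
    by (simp add: x_def is_MAP_def frac_lt_1)
  have Z: "x (Suc j) - x j - real d * \<tau> \<in> \<int>" for j
    unfolding x_def by (rule frac_AP_step)
  note bounds = golden_ratio_bounds assms(3,4)
  have "l \<le> 2 * nat \<lceil>(1 - (2 - \<tau>) - g d) / (1 - 2 * g d)\<rceil>"
  proof (cases rule: g_cases[of d])
    case 1
    have "x (Suc j) - x j - g d = (x (Suc j) - x j - real d * \<tau>) + (real d * \<tau> - g d)" for j
      by simp
    then have "x (Suc j) - x j - g d \<in> \<int>" for j using 1 Z by (metis Ints_add)
    then show ?thesis using bounds mem by (intro rotation_orbit_length_le[where x = x]) auto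
  next
    case 2
    \<comment> \<open>Here \<open>d * \<tau>\<close> is \<open>- g d\<close> modulo 1, so the points
      in reverse order form an orbit of the rotation by \<open>g d\<close>.\<close>
    have rev: "x j - x (Suc j) - g d \<in> \<int>" for j
    proof -
      have "x j - x (Suc j) - g d = - (x (Suc j) - x j - real d * \<tau>) - (real d * \<tau> + g d)" by simp
      then show ?thesis using 2 Z by (metis Ints_diff Ints_minus)
    qed
    show ?thesis
    proof (rule rotation_orbit_length_le[where x = "\<lambda>j. x (l - Suc j)"])
      fix j assume j: "Suc j < l"
      then have "l - Suc j = Suc (l - Suc (Suc j))" by simp
      then show "x (l - Suc (Suc j)) - x (l - Suc j) - g d \<in> \<int>" using rev by simp
    qed (use bounds mem in auto)
  qed
  then show ?thesis by simp
qed

lemma MAP_exists: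
  assumes "2 - \<tau> < g d" "g d < 1/2"
  shows "\<exists>i. is_MAP fib_word d (2 * nat \<lceil>(\<tau> - 1 - g d) / (1 - 2 * g d)\<rceil>) i"
proof -
  \<comment> \<open>Being one less than the ceiling, \<open>m\<close> is strictly below the
    quotient. This leaves a nonempty open interval for \<open>y\<close> between
    \<open>m * (1 - 2 * g d)\<close> and \<open>\<tau> - 1 - g d\<close>.\<close>
  define m where "m = nat \<lceil>(\<tau> - 1 - g d) / (1 - 2 * g d)\<rceil> - 1"
  note bounds = golden_ratio_bounds assms
  have "0 < (\<tau> - 1 - g d) / (1 - 2 * g d)" using bounds by simp
  then have n: "nat \<lceil>(\<tau> - 1 - g d) / (1 - 2 * g d)\<rceil> = Suc m"
    and "real m < (\<tau> - 1 - g d) / (1 - 2 * g d)"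
    unfolding m_def by linarith+
  then have m: "real m * (1 - 2 * g d) < \<tau> - 1 - g d" using bounds by (simp add: field_simps)
  have m0: "0 \<le> real m * (1 - 2 * g d)" using bounds by simp
  define z where
    "z y j = 2 - \<tau> + y - real (j div 2) * (1 - 2 * g d) + real (j mod 2) * g d" for y j
  have z_mem: "2 - \<tau> \<le> z y j \<and> z y j < 1"
    if "real m * (1 - 2 * g d) < y" "y < \<tau> - 1 - g d" "j < 2 * Suc m" for y j
    unfolding z_def using rotation_orbit_mem(1)[of "2 - \<tau>" "g d" m y j] bounds that by simp
  have z_rot: "z y j - z y 0 - real j * g d \<in> \<int>" if "real m * (1 - 2 * g d) < y" "y < \<tau> - 1 - g d" for y j
    unfolding z_def using rotation_orbit_mem(2)[of "2 - \<tau>" "g d" m y j] bounds that by simp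
  have MAP: "is_MAP fib_word d (2 * Suc m) i"
    if "\<And>j. j < 2 * Suc m \<Longrightarrow> \<exists>s. real (i + j * d + 1) * \<tau> - s \<in> \<int> \<and> 2 - \<tau> \<le> s \<and> s < 1" for i
  proof -
    have "fib_word !! (i + j * d) = L0" if j: "j < 2 * Suc m" for j
    proof -
      obtain s where "real (i + j * d + 1) * \<tau> - s \<in> \<int>" "2 - \<tau> \<le> s" "s < 1"
        using \<open>\<And>j. j < 2 * Suc m \<Longrightarrow> \<exists>s. _ j s\<close> j by blast
      then have "frac (real (i + j * d + 1) * \<tau>) = s" using bounds by (simp add: frac_unique_iff)
      then show ?thesis using \<open>2 - \<tau> \<le> s\<close> fib_word_nth_eq_L0_iff by simp
    qed
    from this this[of 0] show ?thesis by (simp add: is_MAP_def)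
  qed
  have "\<exists>i. is_MAP fib_word d (2 * Suc m) i"
  proof (cases rule: g_cases[of d])
    case 1
    \<comment> \<open>The progression has to start at the point
      \<open>z y 0 = 2 - \<tau> + y\<close>; these are the bounds on \<open>y\<close> shifted by
      \<open>2 - \<tau>\<close>.\<close>
    obtain i where i: "2 - \<tau> + real m * (1 - 2 * g d) < frac (real (i + 1) * \<tau>)"
      "frac (real (i + 1) * \<tau>) < 1 - g d"
      by (rule frac_golden_ratio_dense[of "2 - \<tau> + real m * (1 - 2 * g d)" "1 - g d"])
        (use m m0 bounds in auto)
    define y where "y = frac (real (i + 1) * \<tau>) - (2 - \<tau>)"
    have y: "real m * (1 - 2 * g d) < y" "y < \<tau> - 1 - g d" using i by (simp_all add: y_def)
    have "real (i + j * d + 1) * \<tau> - z y j \<in> \<int>" for j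
    proof -
      have "real (i + j * d + 1) * \<tau> - z y j
          = of_int \<lfloor>real (i + 1) * \<tau>\<rfloor> + of_int (int j) * (real d * \<tau> - g d)
            - (z y j - z y 0 - real j * g d)"
        by (simp add: z_def y_def frac_def algebra_simps)
      also have "\<dots> \<in> \<int>" by (intro Ints_add Ints_diff Ints_mult Ints_of_int 1 z_rot[OF y])
      finally show ?thesis .
    qed
    then show ?thesis using z_mem[OF y] MAP[of i] by blast
  next
    case 2
    \<comment> \<open>The progression now runs through \<open>z y\<close> backwards, so its first
      point is \<open>z y (2 * m + 1) = 2 - \<tau> + y - m * (1 - 2 * g d) + g d\<close>. These
      bounds are the ones on \<open>y\<close> after that shift.\<close>
    obtain i where i: "2 - \<tau> + g d < frac (real (i + 1) * \<tau>)"
      "frac (real (i + 1) * \<tau>) < 1 - real m * (1 - 2 * g d)"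
      by (rule frac_golden_ratio_dense[of "2 - \<tau> + g d" "1 - real m * (1 - 2 * g d)"])
        (use m m0 bounds in auto)
    define y where "y = frac (real (i + 1) * \<tau>) - (2 - \<tau>) - g d + real m * (1 - 2 * g d)"
    have y: "real m * (1 - 2 * g d) < y" "y < \<tau> - 1 - g d" using i by (simp_all add: y_def)
    have "real (i + j * d + 1) * \<tau> - z y (2 * m + 1 - j) \<in> \<int>" if j: "j < 2 * Suc m" for j
    proof -
      have last: "z y (2 * m + 1) = frac (real (i + 1) * \<tau>)" by (simp add: z_def y_def)
      have "real (2 * m + 1 - j) = real (2 * m + 1) - real j" using j by (simp add: of_nat_diff)
      then have "real (i + j * d + 1) * \<tau> - z y (2 * m + 1 - j)
          = of_int \<lfloor>real (i + 1) * \<tau>\<rfloor> + of_int (int j) * (real d * \<tau> + g d)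
            + (z y (2 * m + 1) - z y 0 - real (2 * m + 1) * g d)
            - (z y (2 * m + 1 - j) - z y 0 - real (2 * m + 1 - j) * g d)"
        unfolding last by (simp add: frac_def algebra_simps)
      also have "\<dots> \<in> \<int>" by (intro Ints_add Ints_diff Ints_mult Ints_of_int 2 z_rot[OF y])
      finally show ?thesis .
    qed
    moreover have "2 - \<tau> \<le> z y (2 * m + 1 - j) \<and> z y (2 * m + 1 - j) < 1" for j
      using z_mem[OF y] by simp
    ultimately show ?thesis using MAP[of i] by blast
  qed
  then show ?thesis by (simp add: n)
qed

theorem theorem4p15:
  fixes d :: nat
  assumes "d \<ge> 2"
    and "golden_ratio powi (-2) \<le> g d" and "g d \<le> 1 / 2"
  shows "A d = enat (2 * nat \<lceil>(golden_ratio powi (-1) - g d) / g (2 * d)\<rceil>)"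
proof -
  \<comment> \<open>Irrationality makes both inequalities strict, as the orbit arguments
    require.\<close>
  have gd: "2 - \<tau> < g d" "g d < 1/2"
    using assms g_ne_golden[of d] g_ne_half[of d] by (simp_all add: golden_ratio_powi)
  define n where "n = nat \<lceil>(\<tau> - 1 - g d) / (1 - 2 * g d)\<rceil>"
  \<comment> \<open>Positivity gives \<open>1 \<le> n\<close>, so the bound 1 for progressions on
    the letter \<open>L1\<close> stays below \<open>2 * n\<close>.\<close>
  have "0 < (\<tau> - 1 - g d) / (1 - 2 * g d)" using gd golden_ratio_bounds by simp
  then have "1 \<le> n" unfolding n_def by linarith
  have le: "l \<le> 2 * n" if MAP: "is_MAP fib_word d l i" for l i
  proof (cases "fib_word !! i")
    case L0
    then show ?thesis using MAP_L0_length_le[OF MAP _ gd] by (simp add: n_def)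
  next
    case L1
    then show ?thesis using MAP_L1_length_le[OF MAP _ gd] \<open>1 \<le> n\<close> by simp
  qed
  have "A d = enat (2 * n)"
    unfolding A_def
  proof (rule antisym)
    show "(SUP l \<in> {l. \<exists>i. is_MAP fib_word d l i}. enat l) \<le> enat (2 * n)"
      using le by (intro SUP_least) auto
    show "enat (2 * n) \<le> (SUP l \<in> {l. \<exists>i. is_MAP fib_word d l i}. enat l)"
      using MAP_exists[OF gd] by (intro SUP_upper) (simp add: n_def)
  qed
  moreover have "g (2 * d) = 1 - 2 * g d" using gd golden_ratio_bounds by (intro g_double) auto
  ultimately show ?thesis unfolding golden_ratio_powi by (simp add: n_def)
qed

end
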